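(* (i) Let $(t_\ast,\mathbf x_\ast)$ with $\mathbf x_\ast=(x_{\ast,1},\dots,x_{\ast,n})^T$ be an equilibrium on the horizon $\mathcal E$ for the desingularized vector field $g^{\rm ext}$. Assume that $C_\ast=G(t_\ast,\mathbf x_\ast)$ is positive, so that $r_{\mathbf x_\ast}=(kC_\ast)^{-1/k}>0$ is well-defined. Then $(t_\ast,\mathbf Y_0)$ with $$\mathbf Y_0=(Y_{0,1},\dots,Y_{0,n})^T=(r_{\mathbf x_\ast}^{\alpha_1}x_{\ast,1},\dots,r_{\mathbf x_\ast}^{\alpha_n}x_{\ast,n})^T=r_{\mathbf x_\ast}^{\Lambda_\alpha}\mathbf x_\ast$$ is a root of the balance law $$-\frac1k\Lambda^{\rm ext}_\alpha\begin{pmatrix}t_\ast\\ \mathbf Y_0\end{pmatrix}+f^{\rm ext}_{\alpha,k}(t_\ast,\mathbf Y_0)=0 .$$ (ii) Conversely, let $(t_\ast,\mathbf Y_0)$ with $\mathbf Y_0\not\equiv0$ be a root of this balance law. Then $(t_\ast,\mathbf x_\ast)$ with $$\mathbf x_\ast=(r_{\mathbf Y_0}^{-\alpha_1}Y_{0,1},\dots,r_{\mathbf Y_0}^{-\alpha_n}Y_{0,n})^T=r_{\mathbf Y_0}^{-\Lambda_\alpha}\mathbf Y_0,\qquad\text{where } r_{\mathbf Y_0}=p_\alpha(\mathbf Y_0)>0,$$ is an equilibrium on the horizon for $g^{\rm ext}$. Finally, the quantity $C_\ast=G(t_\ast,\mathbf x_\ast)$ constructed from this $(t_\ast,\mathbf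 x_\ast)$ is positive.
   Context: $n\ge1$, $f:\mathbb R\times\tilde U\to\mathbb R^n$ is $C^r$, $r\ge1$; the ODE $\mathbf y'=f(t,\mathbf y)$ is written in extended form $(t,\mathbf y)'=f^{\rm ext}(t,\mathbf y)=(1,f(t,\mathbf y))^T$, with $f_0\equiv1$. Let $\alpha=(0,\alpha_1,\dots,\alpha_n)$ be nonnegative integers, not all zero, $I_\alpha=\{i:\alpha_i>0\}$, $\Lambda_\alpha={\rm diag}(\alpha_1,\dots,\alpha_n)$, $\Lambda_\alpha^{\rm ext}={\rm diag}(0,\alpha_1,\dots,\alpha_n)$, $s^{\Lambda_\alpha}={\rm diag}(s^{\alpha_1},\dots,s^{\alpha_n})$. $\tilde U$ is the set of $\mathbf y$ with $y_i\in\mathbb R$ arbitrary for $i\in I_\alpha$ and the remaining coordinates in some open set. $f$ is asymptotically quasi-homogeneous of type $\alpha$ and order $k+1$ ($k>0$): there is $f_{\alpha,k}=(f_{1;\alpha,k},\dots,f_{n;\alpha,k})$ with $f_{i;\alpha,k}(t,s^{\Lambda_\alpha}\mathbf y)=s^{k+\alpha_i}f_{i;\alpha,k}(t,\mathbf y)$ for all $s>0$, and $f_i(t,s^{\Lambda_\alpha}\mathbf y)-s^{k+\alpha_i}f_{i;\alpha,k}(t,\mathbf y)=o(s^{k+\alpha_i})$ as $s\to\infty$, uniformly on $\sum_{i\in I_\alpha}y_i^2=1$ with $t$ and the coordinates $y_j$, $j\notin I_\alpha$, in any compact set. $f^{\rm ext}_{\alpha,k}=(0,f_{\alpha,k})^T$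 (so the $0$-th component of the balance law is trivial). $c$ is the least common multiple of $\alpha_i$ ($i\in I_\alpha$), $\beta_i=c/\alpha_i$ for $i\in I_\alpha$; $p_\alpha(\mathbf x)=(\sum_{i\in I_\alpha}x_i^{2\beta_i})^{1/2c}$; $\kappa_\alpha(\mathbf x)=(1-p_\alpha(\mathbf x)^{2c})^{-1}$; the embedding is $y_j=\kappa_\alpha(\mathbf x)^{\alpha_j}x_j$, $t$ unchanged. The horizon is $\mathcal E=\{(t,\mathbf x):p_\alpha(\mathbf x)=1\}$. $\tilde f_j(t,\mathbf x)=\kappa_\alpha^{-(k+\alpha_j)}f_j(t,\kappa_\alpha^{\Lambda_\alpha}\mathbf x)$, $j=0,\dots,n$ (so $\tilde f_0=\kappa_\alpha^{-k}$), for $p_\alpha(\mathbf x)<1$, extended continuously to $\mathcal E$ (where $\tilde f_0=0$ and $\tilde f_j=f_{j;\alpha,k}$, $j\ge1$); $\tilde f^{\rm ext}=(\tilde f_0,\dots,\tilde f_n)^T$; $G(t,\mathbf x)=\sum_{j\in I_\alpha}\frac{x_j^{2\beta_j-1}}{\alpha_j}\tilde f_j(t,\mathbf x)$. The desingularized vector field on $\{p_\alpha(\mathbf x)\le1\}$ is $$g^{\rm ext}(t,\mathbf x)=\Big(1-\tfrac{2c-1}{2c}(1-p_\alpha(\mathbf x)^{2c})\Big)\tilde f^{\rm ext}(t,\mathbf x)-G(t,\mathbf x)\Lambda_\alpha^{\rm ext}\begin{pmatrix}t\\ \mathbf x\end{pmatrix}.$$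
   Formalization: In (ii), "Y_0 not identically 0" is read as "Y_{0,i} ≠ 0 for some i in I_α", i.e. p_α(Y_0)>0; otherwise (ii) fails, e.g. n=2, α=(1,0), k=1, f=(y_1^2,0), Y_0=(0,1), where p_α(Y_0)=0 and x_* is undefined. *)

theory Defs
  imports "HOL-Analysis.Analysis"
begin

text \<open>
  A point \<open>y\<close> of n-space is a vector of type \<open>real ^ 'n\<close>, and a point \<open>(t, y)\<close> of the extended
  phase space is a pair of type \<open>real \<times> (real ^ 'n)\<close>. The \<open>0\<close>-th exponent of the type
  is always \<open>0\<close>; \<open>\<alpha> :: 'n \<Rightarrow> nat\<close> lists the remaining ones.
\<close>

definition index_set :: "('n::finite \<Rightarrow> nat) \<Rightarrow> 'n set" where
  "index_set \<alpha> = {i. \<alpha> i > 0}"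

text \<open>
  The coordinates with index outside \<open>index_set \<alpha>\<close>. They live in the space
  obtained from n-space by setting the other coordinates to \<open>0\<close>.
\<close>

definition off_part :: "('n::finite \<Rightarrow> nat) \<Rightarrow> real ^ 'n \<Rightarrow> real ^ 'n" where
  "off_part \<alpha> y = (\<chi> j. if j \<in> index_set \<alpha> then 0 else y $ j)"

definition off_space :: "('n::finite \<Rightarrow> nat) \<Rightarrow> (real ^ 'n) set" where
  "off_space \<alpha> = {w. \<forall>i\<in>index_set \<alpha>. w $ i = 0}"

definition phase_space :: "('n::finite \<Rightarrow> nat) \<Rightarrow> (real ^ 'n) set \<Rightarrow> (real ^ 'n) set" where
  "phase_space \<alpha> V = {y. off_part \<alpha> y \<in> V}"

definition qscale :: "('n::finite \<Rightarrow> nat) \<Rightarrow> real \<Rightarrow> real ^ 'n \<Rightarrow> real ^ 'n" where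
  "qscale \<alpha> s y = (\<chi> i. s ^ \<alpha> i * y $ i)"

definition Lambda_ext :: "('n::finite \<Rightarrow> nat) \<Rightarrow> real \<times> (real ^ 'n) \<Rightarrow> real \<times> (real ^ 'n)" where
  "Lambda_ext \<alpha> z = (0, \<chi> i. real (\<alpha> i) * snd z $ i)"

text \<open>Functions of class \<open>C^r\<close> on an open set.\<close>

fun C_on :: "nat \<Rightarrow> ('a::real_normed_vector \<Rightarrow> 'b::real_normed_vector) \<Rightarrow> 'a set \<Rightarrow> bool" where
  "C_on 0 F S \<longleftrightarrow> continuous_on S F"
| "C_on (Suc r) F S \<longleftrightarrow>
     (\<forall>x\<in>S. F differentiable (at x)) \<and> (\<forall>v. C_on r (\<lambda>x. frechet_derivative F (at x) v) S)"

definition asymptotically_quasi_homogeneous ::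
    "('n::finite \<Rightarrow> nat) \<Rightarrow> real \<Rightarrow> (real ^ 'n) set \<Rightarrow> (real \<Rightarrow> real ^ 'n \<Rightarrow> real ^ 'n) \<Rightarrow>
     (real \<Rightarrow> real ^ 'n \<Rightarrow> real ^ 'n) \<Rightarrow> bool" where
  "asymptotically_quasi_homogeneous \<alpha> k V f fa \<longleftrightarrow>
     (\<forall>i t. \<forall>y\<in>phase_space \<alpha> V. \<forall>s>0.
        fa t (qscale \<alpha> s y) $ i = s powr (k + real (\<alpha> i)) * fa t y $ i) \<and>
     (\<forall>i K. compact K \<and> K \<subseteq> UNIV \<times> V \<longrightarrow>
        (\<forall>\<epsilon>>0. eventually (\<lambda>s. \<forall>t y.
            (\<Sum>j\<in>index_set \<alpha>. (y $ j)\<^sup>2) = 1 \<and> (t, off_part \<alpha> y) \<in> K \<longrightarrow>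
            \<bar>f t (qscale \<alpha> s y) $ i - s powr (k + real (\<alpha> i)) * fa t y $ i\<bar>
              \<le> \<epsilon> * s powr (k + real (\<alpha> i))) at_top))"

definition c_lcm :: "('n::finite \<Rightarrow> nat) \<Rightarrow> nat" where
  "c_lcm \<alpha> = Lcm (\<alpha> ` index_set \<alpha>)"

text \<open>Exact division, meaningful for \<open>i \<in> index_set \<alpha>\<close> only.\<close>

definition beta :: "('n::finite \<Rightarrow> nat) \<Rightarrow> 'n \<Rightarrow> nat" where
  "beta \<alpha> i = c_lcm \<alpha> div \<alpha> i"

definition p_fun :: "('n::finite \<Rightarrow> nat) \<Rightarrow> real ^ 'n \<Rightarrow> real" where
  "p_fun \<alpha> x = root (2 * c_lcm \<alpha>) (\<Sum>i\<in>index_set \<alpha>. (x $ i) ^ (2 * beta \<alpha> i))"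

definition kappa :: "('n::finite \<Rightarrow> nat) \<Rightarrow> real ^ 'n \<Rightarrow> real" where
  "kappa \<alpha> x = inverse (1 - p_fun \<alpha> x ^ (2 * c_lcm \<alpha>))"

definition f_ext :: "(real \<Rightarrow> real ^ 'n \<Rightarrow> real ^ 'n) \<Rightarrow> real \<times> (real ^ 'n) \<Rightarrow> real \<times> (real ^ 'n)" where
  "f_ext f z = (1, f (fst z) (snd z))"

definition f_tilde_interior ::
    "('n::finite \<Rightarrow> nat) \<Rightarrow> real \<Rightarrow> (real \<Rightarrow> real ^ 'n \<Rightarrow> real ^ 'n) \<Rightarrow>
     real \<times> (real ^ 'n) \<Rightarrow> real \<times> (real ^ 'n)" where
  "f_tilde_interior \<alpha> k f z =
     (let \<kappa> = kappa \<alpha> (snd z); w = f_ext f (fst z, qscale \<alpha> \<kappa> (snd z))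
      in (\<kappa> powr (- k) * fst w, \<chi> j. \<kappa> powr (- (k + real (\<alpha> j))) * snd w $ j))"

text \<open>
  The continuous extension of \<open>f_tilde_interior\<close> from \<open>p_fun \<alpha> x < 1\<close> to the horizon
  \<open>p_fun \<alpha> x = 1\<close> is taken as the limit from the interior. For a vector field \<open>f\<close> which is
  asymptotically quasi-homogeneous with principal part \<open>fa\<close>, this limit
  at \<open>(t, x)\<close> is \<open>(0, fa t x)\<close>.
\<close>

definition f_tilde ::
    "('n::finite \<Rightarrow> nat) \<Rightarrow> real \<Rightarrow> (real ^ 'n) set \<Rightarrow> (real \<Rightarrow> real ^ 'n \<Rightarrow> real ^ 'n) \<Rightarrow>
     real \<times> (real ^ 'n) \<Rightarrow> real \<times> (real ^ 'n)" where
  "f_tilde \<alpha> k V f z =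
     (if p_fun \<alpha> (snd z) < 1 then f_tilde_interior \<alpha> k f z
      else Lim (at z within {(t, x). x \<in> phase_space \<alpha> V \<and> p_fun \<alpha> x < 1})
             (f_tilde_interior \<alpha> k f))"

definition G_fun ::
    "('n::finite \<Rightarrow> nat) \<Rightarrow> real \<Rightarrow> (real ^ 'n) set \<Rightarrow> (real \<Rightarrow> real ^ 'n \<Rightarrow> real ^ 'n) \<Rightarrow>
     real \<times> (real ^ 'n) \<Rightarrow> real" where
  "G_fun \<alpha> k V f z =
     (\<Sum>j\<in>index_set \<alpha>. (snd z $ j) ^ (2 * beta \<alpha> j - 1) / real (\<alpha> j) * snd (f_tilde \<alpha> k V f z) $ j)"

definition g_ext ::
    "('n::finite \<Rightarrow> nat) \<Rightarrow> real \<Rightarrow> (real ^ 'n) set \<Rightarrow> (real \<Rightarrow> real ^ 'n \<Rightarrow> real ^ 'n) \<Rightarrow>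
     real \<times> (real ^ 'n) \<Rightarrow> real \<times> (real ^ 'n)" where
  "g_ext \<alpha> k V f z =
     (let c = c_lcm \<alpha> in
      (1 - (2 * real c - 1) / (2 * real c) * (1 - p_fun \<alpha> (snd z) ^ (2 * c))) *\<^sub>R f_tilde \<alpha> k V f z
      - G_fun \<alpha> k V f z *\<^sub>R Lambda_ext \<alpha> z)"

definition horizon :: "('n::finite \<Rightarrow> nat) \<Rightarrow> (real ^ 'n) set \<Rightarrow> (real \<times> (real ^ 'n)) set" where
  "horizon \<alpha> V = {(t, x). x \<in> phase_space \<alpha> V \<and> p_fun \<alpha> x = 1}"

definition equilibrium_on_horizon ::
    "('n::finite \<Rightarrow> nat) \<Rightarrow> real \<Rightarrow> (real ^ 'n) set \<Rightarrow> (real \<Rightarrow> real ^ 'n \<Rightarrow> real ^ 'n) \<Rightarrow>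
     real \<times> (real ^ 'n) \<Rightarrow> bool" where
  "equilibrium_on_horizon \<alpha> k V f z \<longleftrightarrow> z \<in> horizon \<alpha> V \<and> g_ext \<alpha> k V f z = 0"

definition balance_root ::
    "('n::finite \<Rightarrow> nat) \<Rightarrow> real \<Rightarrow> (real ^ 'n) set \<Rightarrow> (real \<Rightarrow> real ^ 'n \<Rightarrow> real ^ 'n) \<Rightarrow>
     real \<times> (real ^ 'n) \<Rightarrow> bool" where
  "balance_root \<alpha> k V fa z \<longleftrightarrow>
     snd z \<in> phase_space \<alpha> V \<and>
     - (1 / k) *\<^sub>R Lambda_ext \<alpha> z + (0, fa (fst z) (snd z)) = 0"

end

theory Submission
  imports Defs
begin

text \<open>
  On the horizon the factor in front of \<open>f_tilde\<close> in \<open>g_ext\<close> is \<open>1\<close>, and \<open>f_tilde\<close> is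
  \<open>(0, fa)\<close>. An equilibrium \<open>(t, x)\<close> is therefore a solution of the eigenvalue-like equation
  \<open>fa\<^sub>i (t, x) = G \<alpha>\<^sub>i x\<^sub>i\<close>, whose multiplier is \<open>G = G_fun (t, x)\<close>, while a balance root \<open>(t, Y)\<close>
  solves the same equation with the multiplier \<open>1 / k\<close>. Since \<open>fa\<close> is quasi-homogeneous, replacing
  \<open>x\<close> by \<open>qscale \<alpha> s x\<close> multiplies the multiplier by \<open>s powr k\<close>. Both directions thus amount to a
  choice of \<open>s\<close>: in the first it is determined by \<open>s powr k * G = 1 / k\<close>, in the second by the
  condition that the rescaled point lies on the horizon. In the second direction it remains
  to see that the multiplier is indeed \<open>G\<close>: pairing the equation with the weights
  \<open>x\<^sub>j ^ (2 \<beta>\<^sub>j - 1) / \<alpha>\<^sub>j\<close> of \<open>G\<close> leaves the multiplier times \<open>\<Sum> x\<^sub>j ^ (2 \<beta>\<^sub>j) = 1\<close>.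

  The analytic part is the identification of \<open>f_tilde\<close>, defined as a limit from the interior,
  with \<open>(0, fa)\<close> (lemma \<open>f_tilde_on_horizon\<close>). The asymptotic hypothesis only controls \<open>f\<close> on
  scaled copies of the Euclidean sphere in the coordinates of \<open>index_set \<alpha>\<close>. Moving points to this
  sphere by scalings that stay in a compact subset of the positive half-line (lemma
  \<open>scale_to_sphere\<close>) turns it into locally uniform convergence of the rescaled fields to \<open>fa\<close>
  (lemma \<open>rescaled_component_uniform_limit\<close>). This yields both that \<open>fa\<close> is continuous near the horizon and
  that the scale may be taken to be \<open>kappa\<close> of the moving point, which tends to infinity at the
  horizon.
\<close>

section \<open>Quasi-homogeneous scaling\<close>

lemma alpha_mult_beta:
  assumes "i \<in> index_set \<alpha>"
  shows "\<alpha> i * beta \<alpha> i = c_lcm \<alpha>"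
  using assms unfolding beta_def c_lcm_def by (intro dvd_mult_div_cancel dvd_Lcm) auto

lemma c_lcm_pos: "c_lcm \<alpha> > 0"
proof -
  have "Lcm (\<alpha> ` index_set \<alpha>) \<noteq> 0"
    by (subst Lcm_0_iff) (auto simp: index_set_def)
  then show ?thesis unfolding c_lcm_def by (rule neq0_conv[THEN iffD1])
qed

lemma beta_pos:
  assumes "i \<in> index_set \<alpha>"
  shows "beta \<alpha> i > 0"
  using alpha_mult_beta[OF assms] c_lcm_pos[of \<alpha>] by (cases "beta \<alpha> i") auto

lemma qscale_nth [simp]: "qscale \<alpha> s y $ i = s ^ \<alpha> i * y $ i"
  by (simp add: qscale_def)

lemma qscale_qscale: "qscale \<alpha> s (qscale \<alpha> q y) = qscale \<alpha> (s * q) y"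
  by (simp add: vec_eq_iff power_mult_distrib)

lemma qscale_one [simp]: "qscale \<alpha> 1 y = y"
  by (simp add: vec_eq_iff)

lemma off_part_qscale [simp]: "off_part \<alpha> (qscale \<alpha> s y) = off_part \<alpha> y"
  by (simp add: vec_eq_iff off_part_def index_set_def)

lemma qscale_mem_phase_space [simp]: "qscale \<alpha> s y \<in> phase_space \<alpha> V \<longleftrightarrow> y \<in> phase_space \<alpha> V"
  by (simp add: phase_space_def)

lemma p_fun_power: "p_fun \<alpha> x ^ (2 * c_lcm \<alpha>) = (\<Sum>i\<in>index_set \<alpha>. (x $ i) ^ (2 * beta \<alpha> i))"
  unfolding p_fun_def using c_lcm_pos[of \<alpha>]
  by (intro real_root_pow_pos2) (auto intro!: sum_nonneg zero_le_even_power)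

text \<open>The exponents \<open>\<beta>\<^sub>i\<close> are chosen so that \<open>\<alpha>\<^sub>i \<beta>\<^sub>i = c\<close> for all \<open>i\<close>.\<close>

lemma p_fun_qscale:
  assumes "s \<ge> 0"
  shows "p_fun \<alpha> (qscale \<alpha> s x) = s * p_fun \<alpha> x"
proof -
  have "(s ^ \<alpha> i * x $ i) ^ (2 * beta \<alpha> i) = s ^ (2 * c_lcm \<alpha>) * (x $ i) ^ (2 * beta \<alpha> i)"
    if "i \<in> index_set \<alpha>" for i
    by (simp only: power_mult_distrib power_mult[symmetric] alpha_mult_beta[OF that, symmetric]
        mult.left_commute)
  then have "(\<Sum>i\<in>index_set \<alpha>. (qscale \<alpha> s x $ i) ^ (2 * beta \<alpha> i)) =
      s ^ (2 * c_lcm \<alpha>) * (\<Sum>i\<in>index_set \<alpha>. (x $ i) ^ (2 * beta \<alpha> i))"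
    by (simp add: sum_distrib_left)
  then show ?thesis
    using assms c_lcm_pos[of \<alpha>]
    by (simp add: p_fun_def real_root_mult real_root_power_cancel)
qed

lemma p_fun_pos:
  assumes "i \<in> index_set \<alpha>" "x $ i \<noteq> 0"
  shows "p_fun \<alpha> x > 0"
proof -
  have "(\<Sum>i\<in>index_set \<alpha>. (x $ i) ^ (2 * beta \<alpha> i)) > 0"
    using assms by (intro sum_pos2[where i = i]) (auto simp: zero_less_power_eq zero_le_even_power)
  then show ?thesis
    unfolding p_fun_def using c_lcm_pos[of \<alpha>] by (intro real_root_gt_zero) auto
qed

lemma p_fun_nonneg: "p_fun \<alpha> x \<ge> 0"
  unfolding p_fun_def using c_lcm_pos[of \<alpha>]
  by (intro real_root_ge_zero sum_nonneg) (auto simp: zero_le_even_power)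

lemma continuous_p_fun: "continuous_on UNIV (p_fun \<alpha>)"
  unfolding p_fun_def by (intro continuous_intros)

lemma continuous_off_part: "continuous_on UNIV (off_part \<alpha>)"
proof -
  have "continuous_on UNIV (\<lambda>x. if j \<in> index_set \<alpha> then 0 else x $ j)" for j
    by (cases "j \<in> index_set \<alpha>") (auto intro!: continuous_intros)
  then show ?thesis
    unfolding off_part_def by (intro continuous_on_vec_lambda)
qed

section \<open>Locally uniform convergence of the rescaled fields\<close>

text \<open>
  As \<open>q\<close> grows from \<open>a \<le> 1\<close> to \<open>B \<ge> 1\<close>, the Euclidean norm of the scaled point passes the value
  \<open>1\<close>, because all the exponents \<open>\<alpha>\<^sub>i\<close> with \<open>i \<in> index_set \<alpha>\<close> are at least \<open>1\<close>. The scale \<open>q\<close> is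
  thus bounded away from \<open>0\<close> and from infinity as long as \<open>y\<close> is.
\<close>

lemma scale_to_sphere:
  fixes y :: "real ^ 'n::finite"
  assumes a: "0 < a" "a \<le> 1" "a\<^sup>2 \<le> (\<Sum>i\<in>index_set \<alpha>. (y $ i)\<^sup>2)"
    and B: "1 \<le> B" "(\<Sum>i\<in>index_set \<alpha>. (y $ i)\<^sup>2) \<le> B\<^sup>2"
  obtains q u where "a \<le> q" "q \<le> B" "y = qscale \<alpha> q u" "(\<Sum>i\<in>index_set \<alpha>. (u $ i)\<^sup>2) = 1"
proof -
  define h where "h q = (\<Sum>i\<in>index_set \<alpha>. (y $ i / q ^ \<alpha> i)\<^sup>2)" for q
  have "h B \<le> (\<Sum>i\<in>index_set \<alpha>. (y $ i)\<^sup>2 / B\<^sup>2)"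
    unfolding h_def
  proof (intro sum_mono)
    fix i assume "i \<in> index_set \<alpha>"
    then have "B ^ 1 \<le> B ^ \<alpha> i"
      using B by (intro power_increasing) (auto simp: index_set_def)
    then have "B\<^sup>2 \<le> (B ^ \<alpha> i)\<^sup>2"
      using B by (intro power_mono) auto
    then show "(y $ i / B ^ \<alpha> i)\<^sup>2 \<le> (y $ i)\<^sup>2 / B\<^sup>2"
      unfolding power_divide using B by (intro divide_left_mono mult_pos_pos) auto
  qed
  also have "\<dots> \<le> 1"
    using B by (simp flip: sum_divide_distrib)
  finally have hB: "h B \<le> 1" .
  have "1 \<le> (\<Sum>i\<in>index_set \<alpha>. (y $ i)\<^sup>2 / a\<^sup>2)"
    using a by (simp flip: sum_divide_distrib)
  also have "\<dots> \<le> h a"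
    unfolding h_def
  proof (intro sum_mono)
    fix i assume "i \<in> index_set \<alpha>"
    then have "a ^ \<alpha> i \<le> a ^ 1"
      using a by (intro power_decreasing) (auto simp: index_set_def)
    then have "(a ^ \<alpha> i)\<^sup>2 \<le> a\<^sup>2"
      using a by (intro power_mono) auto
    then show "(y $ i)\<^sup>2 / a\<^sup>2 \<le> (y $ i / a ^ \<alpha> i)\<^sup>2"
      unfolding power_divide using a by (intro divide_left_mono mult_pos_pos) auto
  qed
  finally have ha: "1 \<le> h a" .
  have "continuous_on {a..B} h"
    unfolding h_def using a by (intro continuous_intros) auto
  then obtain q where q: "a \<le> q" "q \<le> B" "h q = 1"
    using IVT2'[of h B 1 a] hB ha a B by auto
  show thesis
  proof (rule that[OF q(1,2)])
    show "y = qscale \<alpha> q (\<chi> i. y $ i / q ^ \<alpha> i)"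
      using q a by (simp add: vec_eq_iff)
    show "(\<Sum>i\<in>index_set \<alpha>. ((\<chi> i. y $ i / q ^ \<alpha> i) $ i)\<^sup>2) = 1"
      using q by (simp add: h_def)
  qed
qed

lemma quasi_homogeneous_principal_part:
  assumes "asymptotically_quasi_homogeneous \<alpha> k V f fa" "y \<in> phase_space \<alpha> V" "s > 0"
  shows "fa t (qscale \<alpha> s y) $ i = s powr (k + real (\<alpha> i)) * fa t y $ i"
  using assms unfolding asymptotically_quasi_homogeneous_def by blast

definition rescaled_component ::
    "('n::finite \<Rightarrow> nat) \<Rightarrow> real \<Rightarrow> (real \<Rightarrow> real ^ 'n \<Rightarrow> real ^ 'n) \<Rightarrow> 'n \<Rightarrow> real \<Rightarrow>
     real \<times> (real ^ 'n) \<Rightarrow> real" where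
  "rescaled_component \<alpha> k f i s z =
     s powr (- (k + real (\<alpha> i))) * f (fst z) (qscale \<alpha> s (snd z)) $ i"

text \<open>
  A nearby point is \<open>qscale \<alpha> q u\<close> with \<open>u\<close> on the sphere and \<open>q\<close> between two positive
  constants \<open>a\<close> and \<open>B\<close>. Its \<open>s\<close>-rescaling is the \<open>(s * q)\<close>-rescaling of \<open>u\<close>: the bound \<open>a\<close> makes
  \<open>s * q\<close> large, and the bound \<open>B\<close> controls the factor \<open>q powr (k + \<alpha>\<^sub>i)\<close> by which the error grows.
\<close>

lemma rescaled_component_uniform_limit:
  fixes \<alpha> :: "'n::finite \<Rightarrow> nat" and t :: real
  assumes V: "openin (top_of_set (off_space \<alpha>)) V"
    and k: "k > 0"
    and aqh: "asymptotically_quasi_homogeneous \<alpha> k V f fa"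
    and x: "x \<in> phase_space \<alpha> V" "j \<in> index_set \<alpha>" "x $ j \<noteq> 0"
  obtains N where "open N" "(t, x) \<in> N" "N \<subseteq> UNIV \<times> phase_space \<alpha> V"
    "\<And>i. uniform_limit N (rescaled_component \<alpha> k f i) (\<lambda>z. fa (fst z) (snd z) $ i) at_top"
proof -
  define S where "S y = (\<Sum>i\<in>index_set \<alpha>. (y $ i)\<^sup>2)" for y :: "real ^ 'n"
  have Sx: "S x > 0"
    unfolding S_def using x by (intro sum_pos2[where i = j]) auto
  obtain T where T: "open T" "V = T \<inter> off_space \<alpha>"
    using V by (metis openin_open Int_commute)
  have off: "off_part \<alpha> y \<in> off_space \<alpha>" for y
    by (simp add: off_part_def off_space_def)
  have "off_part \<alpha> x \<in> T"
    using x T by (auto simp: phase_space_def)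
  then obtain d where d: "d > 0" "cball (off_part \<alpha> x) d \<subseteq> T"
    using \<open>open T\<close> open_contains_cball by blast
  define K where "K = cball t 1 \<times> (cball (off_part \<alpha> x) d \<inter> off_space \<alpha>)"
  have "closed (off_space \<alpha>)"
    unfolding off_space_def Ball_def
    by (intro closed_Collect_all closed_Collect_imp open_Collect_const closed_Collect_eq
        continuous_intros)
  then have K: "compact K" "K \<subseteq> UNIV \<times> V"
    unfolding K_def using d T by (auto intro!: compact_Times compact_Int_closed)
  \<comment> \<open>\<open>a\<^sup>2\<close> and \<open>B\<^sup>2\<close> enclose the squared norms \<open>S y\<close> of the points of \<open>N\<close> below; the cut-offs at
    \<open>1\<close> are what \<open>scale_to_sphere\<close> asks for.\<close>
  define a where "a = sqrt (min 1 (S x / 2))"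
  define B where "B = sqrt (max 1 (2 * S x))"
  have a: "0 < a" "a \<le> 1" "a\<^sup>2 \<le> S x / 2"
    using Sx by (auto simp: a_def)
  have B: "1 \<le> B" "2 * S x \<le> B\<^sup>2"
    using Sx by (auto simp: B_def)
  define N where "N = ball t 1 \<times> (off_part \<alpha> -` ball (off_part \<alpha> x) d \<inter> S -` {S x / 2 <..< 2 * S x})"
  have "continuous_on UNIV S"
    unfolding S_def by (intro continuous_intros)
  then have 1: "open N"
    unfolding N_def using continuous_off_part[of \<alpha>]
    by (intro open_Times open_Int open_vimage) auto
  have 2: "(t, x) \<in> N"
    using Sx d by (auto simp: N_def)
  have 3: "N \<subseteq> UNIV \<times> phase_space \<alpha> V"
    using d T off by (auto simp: N_def phase_space_def)
  have 4: "uniform_limit N (rescaled_component \<alpha> k f i) (\<lambda>z. fa (fst z) (snd z) $ i) at_top" for i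
  proof (rule uniform_limitI)
    fix e :: real assume e: "e > 0"
    define m where "m = k + real (\<alpha> i)"
    have m: "m > 0" using k by (simp add: m_def)
    \<comment> \<open>The error at \<open>y = qscale \<alpha> q u\<close> is at most \<open>\<epsilon> * q powr m \<le> \<epsilon> * B powr m\<close>; the factor \<open>2\<close> makes
      it strictly smaller than \<open>e\<close>.\<close>
    define \<epsilon> where "\<epsilon> = e / (2 * B powr m)"
    have \<epsilon>: "\<epsilon> > 0" using e B by (simp add: \<epsilon>_def)
    have "eventually (\<lambda>s. \<forall>t y. S y = 1 \<and> (t, off_part \<alpha> y) \<in> K \<longrightarrow>
        \<bar>f t (qscale \<alpha> s y) $ i - s powr m * fa t y $ i\<bar> \<le> \<epsilon> * s powr m) at_top"
      using aqh K \<epsilon> unfolding asymptotically_quasi_homogeneous_def m_def S_def by blast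
    then obtain s0 where s0: "\<And>s t y. s \<ge> s0 \<Longrightarrow> S y = 1 \<Longrightarrow> (t, off_part \<alpha> y) \<in> K \<Longrightarrow>
        \<bar>f t (qscale \<alpha> s y) $ i - s powr m * fa t y $ i\<bar> \<le> \<epsilon> * s powr m"
      unfolding eventually_at_top_linorder by blast
    show "\<forall>\<^sub>F s in at_top. \<forall>z\<in>N. dist (rescaled_component \<alpha> k f i s z) (fa (fst z) (snd z) $ i) < e"
      using eventually_ge_at_top[of "s0 / a"] eventually_gt_at_top[of 0]
    proof eventually_elim
      case (elim s)
      show ?case
      proof
        fix z assume z: "z \<in> N"
        obtain t' y where ty: "z = (t', y)" by (cases z)
        have Sy: "S x / 2 < S y" "S y < 2 * S x"
          using z ty by (auto simp: N_def)
        obtain q u where q: "a \<le> q" "q \<le> B" "y = qscale \<alpha> q u" "S u = 1"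
          using scale_to_sphere[where a = a and B = B and y = y and \<alpha> = \<alpha>] a B Sy unfolding S_def by (smt (verit))
        have y: "y \<in> phase_space \<alpha> V"
          using z 3 ty by auto
        have u: "u \<in> phase_space \<alpha> V"
          using y q by simp
        have "(t', off_part \<alpha> u) \<in> K"
          using z ty q off by (auto simp: N_def K_def)
        moreover have "s0 \<le> s * a"
          using elim a by (simp add: pos_divide_le_eq)
        then have "s0 \<le> s * q"
          using q elim by (smt (verit) mult_left_mono)
        ultimately have "\<bar>f t' (qscale \<alpha> (s * q) u) $ i - (s * q) powr m * fa t' u $ i\<bar>
            \<le> \<epsilon> * (s * q) powr m"
          using s0 q by blast
        then have "\<bar>f t' (qscale \<alpha> s y) $ i - s powr m * fa t' y $ i\<bar> \<le> \<epsilon> * q powr m * s powr m"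
          using q a elim quasi_homogeneous_principal_part[OF aqh u, of q t' i]
          by (simp add: qscale_qscale powr_mult m_def mult_ac)
        moreover have "\<epsilon> * q powr m \<le> \<epsilon> * B powr m"
          using \<epsilon> q a m by (intro mult_left_mono powr_mono2) auto
        moreover have "\<epsilon> * B powr m < e"
          using e B by (simp add: \<epsilon>_def)
        ultimately have "\<bar>f t' (qscale \<alpha> s y) $ i - s powr m * fa t' y $ i\<bar> < e * s powr m"
          using elim by (smt (verit) mult_strict_right_mono powr_gt_zero)
        moreover have "rescaled_component \<alpha> k f i s z - fa t' y $ i =
            (f t' (qscale \<alpha> s y) $ i - s powr m * fa t' y $ i) / s powr m"
          using elim by (simp add: rescaled_component_def ty m_def[symmetric] powr_minus field_simps)
        ultimately show "dist (rescaled_component \<alpha> k f i s z) (fa (fst z) (snd z) $ i) < e"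
          using elim by (simp add: dist_real_def ty divide_less_eq)
      qed
    qed
  qed
  show thesis using that[OF 1 2 3 4] .
qed

text \<open>The rescaled fields are continuous, so their locally uniform limit is continuous as well.\<close>

lemma principal_part_tendsto:
  assumes cont: "continuous_on (UNIV \<times> phase_space \<alpha> V) (\<lambda>(t, y). f t y)"
    and N: "open N" "z \<in> N" "N \<subseteq> UNIV \<times> phase_space \<alpha> V"
    and lim: "uniform_limit N (rescaled_component \<alpha> k f i) (\<lambda>z. fa (fst z) (snd z) $ i) at_top"
  shows "((\<lambda>z. fa (fst z) (snd z) $ i) \<longlongrightarrow> fa (fst z) (snd z) $ i) (nhds z)"
proof -
  have "continuous_on N (rescaled_component \<alpha> k f i s)" for s
  proof -
    have "continuous_on N (\<lambda>z. (fst z, qscale \<alpha> s (snd z)))"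
      unfolding qscale_def by (intro continuous_intros)
    moreover have "(\<lambda>z. (fst z, qscale \<alpha> s (snd z))) ` N \<subseteq> UNIV \<times> phase_space \<alpha> V"
      using N by auto
    ultimately have "continuous_on N (\<lambda>z. (\<lambda>(t, y). f t y) (fst z, qscale \<alpha> s (snd z)))"
      by (rule continuous_on_compose2[OF cont])
    then show ?thesis
      unfolding rescaled_component_def by (auto intro!: continuous_intros)
  qed
  then have "continuous_on N (\<lambda>z. fa (fst z) (snd z) $ i)"
    by (intro uniform_limit_theorem[OF _ lim]) auto
  then show ?thesis
    using N tendsto_at_iff_tendsto_nhds[of "\<lambda>z. fa (fst z) (snd z) $ i" z]
    by (simp add: continuous_on_eq_continuous_at isCont_def)
qed

section \<open>The extended field on the horizon\<close>

lemma kappa_at_top: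
  fixes t :: real and x :: "real ^ 'n::finite"
  assumes "p_fun \<alpha> x = 1"
  shows "filterlim (\<lambda>z. kappa \<alpha> (snd z)) at_top
    (at (t, x) within {(t, x). x \<in> phase_space \<alpha> V \<and> p_fun \<alpha> x < 1})"
proof -
  have "continuous_on UNIV (\<lambda>z::real \<times> (real ^ 'n). 1 - p_fun \<alpha> (snd z) ^ (2 * c_lcm \<alpha>))"
    by (intro continuous_intros continuous_on_compose2[OF continuous_p_fun]) auto
  then have "((\<lambda>z. 1 - p_fun \<alpha> (snd z) ^ (2 * c_lcm \<alpha>)) \<longlongrightarrow> 1 - p_fun \<alpha> (snd (t, x)) ^ (2 * c_lcm \<alpha>))
      (at (t, x) within {(t, x). x \<in> phase_space \<alpha> V \<and> p_fun \<alpha> x < 1})"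
    unfolding continuous_on_def by (blast intro: tendsto_within_subset)
  moreover have "\<forall>\<^sub>F z in at (t, x) within {(t, x). x \<in> phase_space \<alpha> V \<and> p_fun \<alpha> x < 1}.
      1 - p_fun \<alpha> (snd z) ^ (2 * c_lcm \<alpha>) > 0"
    unfolding eventually_at_filter using c_lcm_pos[of \<alpha>] p_fun_nonneg[of \<alpha>]
    by (auto simp: power_less_one_iff intro!: always_eventually)
  ultimately show ?thesis
    unfolding kappa_def using assms by (intro filterlim_inverse_at_top) auto
qed

text \<open>The point is approached along the scalings \<open>qscale \<alpha> s x\<close> with \<open>s\<close> increasing to \<open>1\<close>.\<close>

lemma horizon_limit_of_interior:
  fixes t :: real
  assumes "x \<in> phase_space \<alpha> V" "p_fun \<alpha> x = 1"
  shows "at (t, x) within {(t, x). x \<in> phase_space \<alpha> V \<and> p_fun \<alpha> x < 1} \<noteq> bot"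
proof -
  define D where "D = {(t::real, x). x \<in> phase_space \<alpha> V \<and> p_fun \<alpha> x < 1}"
  define s where "s n = real n / real (Suc n)" for n
  have s: "0 \<le> s n" "s n < 1" for n
    by (auto simp: s_def)
  have "s \<longlonglongrightarrow> 1"
    unfolding s_def by (rule LIMSEQ_n_over_Suc_n)
  then have "(\<lambda>n. (t, qscale \<alpha> (s n) x)) \<longlonglongrightarrow> (t, qscale \<alpha> 1 x)"
    unfolding qscale_def by (intro tendsto_intros vec_tendstoI) (auto intro!: tendsto_eq_intros)
  moreover have "(t, qscale \<alpha> (s n) x) \<in> D" for n
    using s[of n] assms by (simp add: D_def p_fun_qscale)
  ultimately have "(t, x) \<in> closure D"
    unfolding closure_sequential by (intro exI[of _ "\<lambda>n. (t, qscale \<alpha> (s n) x)"]) simp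
  moreover have "(t, x) \<notin> D"
    using assms by (simp add: D_def)
  ultimately show ?thesis
    unfolding D_def[symmetric] trivial_limit_within by (auto simp: closure_def)
qed

lemma horizon_nonzero_coordinate:
  assumes "p_fun \<alpha> x = 1"
  obtains j where "j \<in> index_set \<alpha>" "x $ j \<noteq> 0"
proof -
  have "(\<Sum>i\<in>index_set \<alpha>. (x $ i) ^ (2 * beta \<alpha> i)) \<noteq> 0"
    using assms p_fun_power[of \<alpha> x] by simp
  then obtain j where "j \<in> index_set \<alpha>" "(x $ j) ^ (2 * beta \<alpha> j) \<noteq> 0"
    by (meson sum.neutral)
  then show thesis
    using that beta_pos by fastforce
qed

text \<open>
  In the interior, \<open>f_tilde\<close> is the rescaled field at the scale \<open>kappa\<close> of the point. As the point
  tends to the horizon the scale tends to infinity, and by uniformity the error between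
  the rescaled field and \<open>fa\<close> at the moving point vanishes; continuity of \<open>fa\<close> does the rest.
\<close>

lemma f_tilde_on_horizon:
  fixes \<alpha> :: "'n::finite \<Rightarrow> nat"
  assumes V: "openin (top_of_set (off_space \<alpha>)) V"
    and cont: "continuous_on (UNIV \<times> phase_space \<alpha> V) (\<lambda>(t, y). f t y)"
    and k: "k > 0"
    and aqh: "asymptotically_quasi_homogeneous \<alpha> k V f fa"
    and x: "x \<in> phase_space \<alpha> V" "p_fun \<alpha> x = 1"
  shows "f_tilde \<alpha> k V f (t, x) = (0, fa t x)"
proof -
  define F where "F = at (t, x) within {(t, x). x \<in> phase_space \<alpha> V \<and> p_fun \<alpha> x < 1}"
  have kap: "filterlim (\<lambda>z. kappa \<alpha> (snd z)) at_top F"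
    unfolding F_def by (rule kappa_at_top[OF x(2)])
  obtain j where j: "j \<in> index_set \<alpha>" "x $ j \<noteq> 0"
    using horizon_nonzero_coordinate[OF x(2)] .
  obtain N where N: "open N" "(t, x) \<in> N" "N \<subseteq> UNIV \<times> phase_space \<alpha> V"
    "\<And>i. uniform_limit N (rescaled_component \<alpha> k f i) (\<lambda>z. fa (fst z) (snd z) $ i) at_top"
    by (rule rescaled_component_uniform_limit[OF V k aqh x(1) j, of t]) (rule that)
  have FN: "F \<le> nhds (t, x)"
    unfolding F_def by (simp add: at_within_def)
  have inN: "\<forall>\<^sub>F z in F. z \<in> N"
    using FN eventually_nhds_in_open[OF N(1,2)] by (rule filter_leD)
  have "((\<lambda>z. rescaled_component \<alpha> k f i (kappa \<alpha> (snd z)) z) \<longlongrightarrow> fa t x $ i) F" for i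
  proof -
    have "((\<lambda>z. rescaled_component \<alpha> k f i (kappa \<alpha> (snd z)) z - fa (fst z) (snd z) $ i) \<longlongrightarrow> 0) F"
    proof (rule tendstoI)
      fix e :: real assume "e > 0"
      then have "\<forall>\<^sub>F s in at_top. \<forall>z\<in>N.
          dist (rescaled_component \<alpha> k f i s z) (fa (fst z) (snd z) $ i) < e"
        using N(4) by (intro uniform_limitD)
      then have "\<forall>\<^sub>F z in F. \<forall>w\<in>N.
          dist (rescaled_component \<alpha> k f i (kappa \<alpha> (snd z)) w) (fa (fst w) (snd w) $ i) < e"
        using kap by (rule eventually_compose_filterlim)
      then show "\<forall>\<^sub>F z in F.
          dist (rescaled_component \<alpha> k f i (kappa \<alpha> (snd z)) z - fa (fst z) (snd z) $ i) 0 < e"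
        using inN by eventually_elim (auto simp: dist_real_def)
    qed
    moreover have "((\<lambda>z. fa (fst z) (snd z) $ i) \<longlongrightarrow> fa t x $ i) F"
      using principal_part_tendsto[OF cont N(1-3) N(4)] FN
      by (auto intro: tendsto_mono)
    ultimately show ?thesis
      by (auto dest: tendsto_add)
  qed
  then have "((\<lambda>z. \<chi> i. rescaled_component \<alpha> k f i (kappa \<alpha> (snd z)) z) \<longlongrightarrow> fa t x) F"
    by (intro vec_tendstoI) simp
  moreover have "((\<lambda>z. kappa \<alpha> (snd z) powr (- k)) \<longlongrightarrow> 0) F"
    using k kap by (intro tendsto_neg_powr) auto
  ultimately have "((\<lambda>z. (kappa \<alpha> (snd z) powr (- k),
      \<chi> i. rescaled_component \<alpha> k f i (kappa \<alpha> (snd z)) z)) \<longlongrightarrow> (0, fa t x)) F"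
    by (intro tendsto_Pair)
  then have "(f_tilde_interior \<alpha> k f \<longlongrightarrow> (0, fa t x)) F"
    by (simp add: f_tilde_interior_def[abs_def] rescaled_component_def f_ext_def Let_def)
  then have "Lim F (f_tilde_interior \<alpha> k f) = (0, fa t x)"
    using horizon_limit_of_interior[OF x] unfolding F_def by (intro tendsto_Lim)
  then show ?thesis
    using x by (simp add: f_tilde_def F_def)
qed

lemma G_fun_on_horizon:
  assumes "openin (top_of_set (off_space \<alpha>)) V"
    and "continuous_on (UNIV \<times> phase_space \<alpha> V) (\<lambda>(t, y). f t y)"
    and "k > 0"
    and "asymptotically_quasi_homogeneous \<alpha> k V f fa"
    and "x \<in> phase_space \<alpha> V" "p_fun \<alpha> x = 1"
  shows "G_fun \<alpha> k V f (t, x) =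
    (\<Sum>j\<in>index_set \<alpha>. (x $ j) ^ (2 * beta \<alpha> j - 1) / real (\<alpha> j) * fa t x $ j)"
  by (simp add: G_fun_def f_tilde_on_horizon[OF assms])

lemma equilibrium_on_horizon_iff:
  assumes "openin (top_of_set (off_space \<alpha>)) V"
    and "continuous_on (UNIV \<times> phase_space \<alpha> V) (\<lambda>(t, y). f t y)"
    and "k > 0"
    and "asymptotically_quasi_homogeneous \<alpha> k V f fa"
  shows "equilibrium_on_horizon \<alpha> k V f (t, x) \<longleftrightarrow>
    x \<in> phase_space \<alpha> V \<and> p_fun \<alpha> x = 1 \<and>
    (\<forall>i. fa t x $ i = G_fun \<alpha> k V f (t, x) * (real (\<alpha> i) * x $ i))"
proof -
  have "g_ext \<alpha> k V f (t, x) = 0 \<longleftrightarrow>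
      (\<forall>i. fa t x $ i = G_fun \<alpha> k V f (t, x) * (real (\<alpha> i) * x $ i))"
    if "x \<in> phase_space \<alpha> V" "p_fun \<alpha> x = 1"
    using f_tilde_on_horizon[OF assms that] that
    by (simp add: g_ext_def Let_def Lambda_ext_def vec_eq_iff zero_prod_def)
  then show ?thesis
    by (auto simp: equilibrium_on_horizon_def horizon_def)
qed

lemma balance_root_iff:
  assumes "k > 0"
  shows "balance_root \<alpha> k V fa (t, Y) \<longleftrightarrow>
    Y \<in> phase_space \<alpha> V \<and> (\<forall>i. fa t Y $ i = 1 / k * (real (\<alpha> i) * Y $ i))"
  using assms
  by (auto simp: balance_root_def Lambda_ext_def vec_eq_iff zero_prod_def)

section \<open>Equilibria on the horizon and roots of the balance law\<close>

text \<open>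
  A solution of \<open>fa\<^sub>i (t, y) = \<mu> \<alpha>\<^sub>i y\<^sub>i\<close> is carried by \<open>qscale \<alpha> s\<close> to a solution with the
  multiplier \<open>s powr k * \<mu>\<close>, since the two sides scale with the exponents \<open>k + \<alpha>\<^sub>i\<close> and \<open>\<alpha>\<^sub>i\<close>.
\<close>

lemma qscale_multiplier:
  assumes "asymptotically_quasi_homogeneous \<alpha> k V f fa" "y \<in> phase_space \<alpha> V" "s > 0"
    and "fa t y $ i = \<mu> * (real (\<alpha> i) * y $ i)"
  shows "fa t (qscale \<alpha> s y) $ i = s powr k * \<mu> * (real (\<alpha> i) * qscale \<alpha> s y $ i)"
  using assms(3,4) by (simp add: quasi_homogeneous_principal_part[OF assms(1-3)] powr_add powr_realpow)

lemma C_on_imp_continuous_on: "C_on r F S \<Longrightarrow> continuous_on S F"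
  by (cases r) (auto intro!: differentiable_imp_continuous_on differentiable_at_imp_differentiable_on)

theorem theorem3p7:
  fixes \<alpha> :: "'n::finite \<Rightarrow> nat"
    and V :: "(real ^ 'n) set"
    and f fa :: "real \<Rightarrow> real ^ 'n \<Rightarrow> real ^ 'n"
    and k :: real and r :: nat
  assumes "\<exists>i. \<alpha> i \<noteq> 0"
    and "openin (top_of_set (off_space \<alpha>)) V"
    and "r \<ge> 1" and "C_on r (\<lambda>(t, y). f t y) (UNIV \<times> phase_space \<alpha> V)"
    and "k > 0"
    and "asymptotically_quasi_homogeneous \<alpha> k V f fa"
  shows
    "(\<forall>t x. equilibrium_on_horizon \<alpha> k V f (t, x) \<and> G_fun \<alpha> k V f (t, x) > 0 \<longrightarrow>
        (let \<rho> = (k * G_fun \<alpha> k V f (t, x)) powr (- 1 / k)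
         in \<rho> > 0 \<and> balance_root \<alpha> k V fa (t, \<chi> i. \<rho> ^ \<alpha> i * x $ i))) \<and>
     (\<forall>t Y. balance_root \<alpha> k V fa (t, Y) \<and> (\<exists>i\<in>index_set \<alpha>. Y $ i \<noteq> 0) \<longrightarrow>
        (let \<rho> = p_fun \<alpha> Y; x = (\<chi> i. Y $ i / \<rho> ^ \<alpha> i)
         in \<rho> > 0 \<and> equilibrium_on_horizon \<alpha> k V f (t, x) \<and> G_fun \<alpha> k V f (t, x) > 0))"
proof (intro conjI allI impI; elim conjE)
  have cont: "continuous_on (UNIV \<times> phase_space \<alpha> V) (\<lambda>(t, y). f t y)"
    using assms(4) by (rule C_on_imp_continuous_on)
  note eq_iff = equilibrium_on_horizon_iff[OF assms(2) cont assms(5,6)]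
  {
    fix t x
    assume eq: "equilibrium_on_horizon \<alpha> k V f (t, x)" and G: "G_fun \<alpha> k V f (t, x) > 0"
    define C where "C = G_fun \<alpha> k V f (t, x)"
    define \<rho> where "\<rho> = (k * C) powr (- 1 / k)"
    have \<rho>: "\<rho> > 0"
      using G assms(5) by (simp add: \<rho>_def C_def)
    have "\<rho> powr k = (k * C) powr (- 1)"
      using assms(5) by (simp add: \<rho>_def powr_powr del: powr_minus powr_neg_one)
    then have "\<rho> powr k = inverse (k * C)"
      using G assms(5) by (simp add: C_def powr_minus)
    then have "\<rho> powr k * C = 1 / k"
      using G assms(5) by (simp add: C_def field_simps)
    then have "balance_root \<alpha> k V fa (t, qscale \<alpha> \<rho> x)"
      using eq qscale_multiplier[OF assms(6) _ \<rho>, of x t _ C]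
      unfolding eq_iff balance_root_iff[OF assms(5)] C_def[symmetric] by auto
    then show "let \<rho> = (k * G_fun \<alpha> k V f (t, x)) powr (- 1 / k)
        in \<rho> > 0 \<and> balance_root \<alpha> k V fa (t, \<chi> i. \<rho> ^ \<alpha> i * x $ i)"
      using \<rho> by (simp add: \<rho>_def C_def qscale_def Let_def)
  next
    fix t Y
    assume root: "balance_root \<alpha> k V fa (t, Y)" and nz: "\<exists>i\<in>index_set \<alpha>. Y $ i \<noteq> 0"
    define \<rho> where "\<rho> = p_fun \<alpha> Y"
    have \<rho>: "\<rho> > 0"
      using nz p_fun_pos unfolding \<rho>_def by blast
    define x where "x = qscale \<alpha> (1 / \<rho>) Y"
    have x_eq: "(\<chi> i. Y $ i / \<rho> ^ \<alpha> i) = x"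
      by (simp add: x_def vec_eq_iff power_one_over field_simps)
    have Y: "Y \<in> phase_space \<alpha> V"
      using root by (simp add: balance_root_iff[OF assms(5)])
    have x: "x \<in> phase_space \<alpha> V" "p_fun \<alpha> x = 1"
      using Y \<rho> by (simp_all add: x_def p_fun_qscale \<rho>_def)
    define \<mu> where "\<mu> = (1 / \<rho>) powr k * (1 / k)"
    have \<mu>: "\<mu> > 0"
      using \<rho> assms(5) by (simp add: \<mu>_def)
    have fa: "fa t x $ i = \<mu> * (real (\<alpha> i) * x $ i)" for i
      using root \<rho> qscale_multiplier[OF assms(6) Y, of "1 / \<rho>" t i "1 / k"]
      unfolding balance_root_iff[OF assms(5)] x_def \<mu>_def by simp
    have "(x $ j) ^ (2 * beta \<alpha> j - 1) / real (\<alpha> j) * fa t x $ j = \<mu> * (x $ j) ^ (2 * beta \<alpha> j)"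
      if "j \<in> index_set \<alpha>" for j
    proof -
      have "2 * beta \<alpha> j = Suc (2 * beta \<alpha> j - 1)"
        using beta_pos[OF that] by simp
      then have "(x $ j) ^ (2 * beta \<alpha> j) = x $ j * (x $ j) ^ (2 * beta \<alpha> j - 1)"
        by (metis power_Suc)
      then show ?thesis
        using that by (simp add: fa index_set_def)
    qed
    then have "G_fun \<alpha> k V f (t, x) = \<mu> * p_fun \<alpha> x ^ (2 * c_lcm \<alpha>)"
      by (simp add: G_fun_on_horizon[OF assms(2) cont assms(5,6) x] p_fun_power sum_distrib_left)
    then have G: "G_fun \<alpha> k V f (t, x) = \<mu>"
      using x by simp
    then have "equilibrium_on_horizon \<alpha> k V f (t, x)"
      using x fa by (simp add: eq_iff)
    then show "let \<rho> = p_fun \<alpha> Y; x = (\<chi> i. Y $ i / \<rho> ^ \<alpha> i)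
        in \<rho> > 0 \<and> equilibrium_on_horizon \<alpha> k V f (t, x) \<and> G_fun \<alpha> k V f (t, x) > 0"
      using \<rho> \<mu> G by (simp add: \<rho>_def[symmetric] x_eq Let_def)
  }
qed

end
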